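(* Let $\phi:\mathbb R\to[0,+\infty)$ be a finite-valued Orlicz function with $ces_\phi\neq\{0\}$ (equivalently, $\sum_{i=1}^\infty\phi(1/i)<\infty$). For $a\ge0$ define $$f(a)=2\phi(a)+\sum_{i=3}^\infty\phi\Big(\frac2i a\Big),$$ and let $\alpha>0$ be such that $f(\alpha)=1$. If $\phi\in\Delta_2(0)$, then $ces_\phi$ is rotund if and only if $\phi$ is strictly convex on the interval $[0,\alpha]$.
   Context: A finite-valued map $\phi:\mathbb R\to[0,+\infty)$ is an Orlicz function if it is even, convex, $\phi(0)=0$ and $\phi(u)\to\infty$ as $u\to\infty$ (it is then automatically continuous). One writes $\phi\in\Delta_2(0)$ if there are $K>0$ and $a>0$ such that $\phi(a)>0$ and $\phi(2u)\le K\phi(u)$ for all $u\in[0,a]$. Let $l^0$ be the space of all real sequences $x=(x(i))_{i=1}^\infty$. For $x\in l^0$ put $\sigma x(i)=\frac1i\sum_{j=1}^i|x(j)|$ and $\rho_\phi(x)=\sum_{i=1}^\infty\phi(\sigma x(i))$. The Cesàro–Orlicz sequence space is $ces_\phi=\{x\in l^0:\ \rho_\phi(\lambda x)<\infty\text{ for some }\lambda>0\}$, equipped with the Luxemburg norm $\|x\|_\phi=\inf\{\lambda>0:\rho_\phi(x/\lambda)\le1\}$. For finite-valued $\phi$ with $ces_\phi\ne\{0\}$, the function $f$ in the claim is finite-valued, convex and continuous with $f(0)=0$ and $f(a)\to\infty$ as $a\to\infty$, so a number $\alpha>0$ with $f(\alpha)=1$ exists. A Banach space $X$ with closed unit ball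 $B(X)$ and unit sphere $S(X)$ is rotund if every $x\in S(X)$ is an extreme point of $B(X)$, i.e. for all $y,z\in B(X)$ the equality $2x=y+z$ implies $y=z$. *)

theory Defs
  imports "HOL-Analysis.Analysis"
begin

definition orlicz_function :: "(real \<Rightarrow> real) \<Rightarrow> bool" where
  "orlicz_function \<phi> \<longleftrightarrow>
     (\<forall>u. 0 \<le> \<phi> u) \<and> (\<forall>u. \<phi> (- u) = \<phi> u) \<and> convex_on UNIV \<phi> \<and> \<phi> 0 = 0 \<and>
     filterlim \<phi> at_top at_top"

definition delta2_at_zero :: "(real \<Rightarrow> real) \<Rightarrow> bool" where
  "delta2_at_zero \<phi> \<longleftrightarrow>
     (\<exists>K>0. \<exists>a>0. \<phi> a > 0 \<and> (\<forall>u\<in>{0..a}. \<phi> (2 * u) \<le> K * \<phi> u))"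

definition strictly_convex_on :: "real set \<Rightarrow> (real \<Rightarrow> real) \<Rightarrow> bool" where
  "strictly_convex_on S \<phi> \<longleftrightarrow> convex S \<and>
     (\<forall>t u v. 0 < t \<and> t < 1 \<and> u \<in> S \<and> v \<in> S \<and> u \<noteq> v \<longrightarrow>
        \<phi> ((1 - t) * u + t * v) < (1 - t) * \<phi> u + t * \<phi> v)"

text \<open>
  Sequences are indexed from 0: the term written x(i) with i = 1, 2, ... is
  \<^term>\<open>x (i - 1)\<close>. Hence the divisor \<^term>\<open>Suc i\<close> below.
\<close>

definition cesaro_mean :: "(nat \<Rightarrow> real) \<Rightarrow> nat \<Rightarrow> real" where
  "cesaro_mean x i = (\<Sum>j\<le>i. \<bar>x j\<bar>) / real (Suc i)"

definition ces_modular :: "(real \<Rightarrow> real) \<Rightarrow> (nat \<Rightarrow> real) \<Rightarrow> ennreal" where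
  "ces_modular \<phi> x = (\<Sum>i. ennreal (\<phi> (cesaro_mean x i)))"

definition ces_space :: "(real \<Rightarrow> real) \<Rightarrow> (nat \<Rightarrow> real) set" where
  "ces_space \<phi> = {x. \<exists>c>0. ces_modular \<phi> (\<lambda>i. c * x i) < \<infinity>}"

definition ces_norm :: "(real \<Rightarrow> real) \<Rightarrow> (nat \<Rightarrow> real) \<Rightarrow> real" where
  "ces_norm \<phi> x = Inf {c. 0 < c \<and> ces_modular \<phi> (\<lambda>i. x i / c) \<le> 1}"

text \<open>
  A normed sequence space is given by its carrier \<open>X\<close> and norm \<open>N\<close>; the vector operations
  are pointwise. They are written out because functions carry no \<^class>\<open>real_vector\<close>
  structure, which the library notion of an extreme point requires.
\<close>

definition unit_ball :: "(nat \<Rightarrow> real) set \<Rightarrow> ((nat \<Rightarrow> real) \<Rightarrow> real) \<Rightarrow> (nat \<Rightarrow> real) set" where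
  "unit_ball X N = {x \<in> X. N x \<le> 1}"

definition unit_sphere :: "(nat \<Rightarrow> real) set \<Rightarrow> ((nat \<Rightarrow> real) \<Rightarrow> real) \<Rightarrow> (nat \<Rightarrow> real) set" where
  "unit_sphere X N = {x \<in> X. N x = 1}"

definition rotund :: "(nat \<Rightarrow> real) set \<Rightarrow> ((nat \<Rightarrow> real) \<Rightarrow> real) \<Rightarrow> bool" where
  "rotund X N \<longleftrightarrow>
     (\<forall>x\<in>unit_sphere X N. \<forall>y\<in>unit_ball X N. \<forall>z\<in>unit_ball X N.
        (\<forall>i. 2 * x i = y i + z i) \<longrightarrow> y = z)"

text \<open>
  The series over i = 3, 4, ... is shifted to start at 0. It converges whenever \<open>\<phi>\<close> is an
  Orlicz function with \<open>ces_space \<phi> \<noteq> {\<lambda>_. 0}\<close>, so the real-valued \<^const>\<open>suminf\<close> is its sum.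
\<close>

definition ces_f :: "(real \<Rightarrow> real) \<Rightarrow> real \<Rightarrow> real" where
  "ces_f \<phi> a = 2 * \<phi> a + (\<Sum>n. \<phi> (2 / real (n + 3) * a))"

end

theory Submission
  imports Defs
begin

text \<open>
  Under the \<open>\<Delta>\<^sub>2\<close> condition the unit sphere is the level set of the modular at 1. If \<open>2x = y + z\<close>
  with \<open>x\<close> on the sphere and \<open>y\<close>, \<open>z\<close> in the ball, then convexity is tight in every term: each mean
  of \<open>x\<close> is the midpoint of those of \<open>y\<close> and \<open>z\<close>, and so is its value under \<open>\<phi>\<close>. Strict convexity
  on \<open>[0, \<alpha>]\<close> forces the means of \<open>y\<close> and \<open>z\<close> to agree wherever the mean of \<open>x\<close> is at most \<open>\<alpha>\<close>. Two
  means of \<open>x\<close> above \<open>\<alpha>\<close> would make its modular exceed \<open>f(\<alpha>) = 1\<close>, so there is at most one exceptional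
  index, and there the means agree because \<open>y\<close> and \<open>z\<close> have equal modulars.
  Conversely, if \<open>\<phi>\<close> is affine around \<open>c\<close> in \<open>[0, \<alpha>]\<close>, choose \<open>g\<close> so that means
  \<open>c, c, 2g/3, 2g/4, ...\<close> have modular 1; exchanging the first two for \<open>c + d, c - d\<close>
  or \<open>c - d, c + d\<close> keeps the modular.
\<close>

section \<open>Series of convex functions, Cesaro means, strict convexity at midpoints\<close>

text \<open>Serves to make the modular convex along rays, from which its continuity follows.\<close>

lemma convex_on_suminf:
  fixes f :: "nat \<Rightarrow> 'a::real_vector \<Rightarrow> real"
  assumes "\<And>n. convex_on S (f n)" "\<And>x. x \<in> S \<Longrightarrow> summable (\<lambda>n. f n x)" "convex S"
  shows "convex_on S (\<lambda>x. \<Sum>n. f n x)"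
proof (rule convex_onI)
  fix t x y assume t: "0 < t" "t < (1::real)" and xy: "x \<in> S" "y \<in> S"
  have mem: "(1 - t) *\<^sub>R x + t *\<^sub>R y \<in> S"
    using \<open>convex S\<close> t xy by (simp add: convex_alt)
  have "(\<Sum>n. f n ((1 - t) *\<^sub>R x + t *\<^sub>R y)) \<le> (\<Sum>n. (1 - t) * f n x + t * f n y)"
    using assms(1,2) t xy mem
    by (intro suminf_le summable_add summable_mult convex_onD) auto
  also have "\<dots> = (1 - t) * (\<Sum>n. f n x) + t * (\<Sum>n. f n y)"
    using assms(2) xy by (simp add: suminf_add[symmetric] suminf_mult summable_mult)
  finally show "(\<Sum>n. f n ((1 - t) *\<^sub>R x + t *\<^sub>R y)) \<le> (1 - t) * (\<Sum>n. f n x) + t * (\<Sum>n. f n y)" .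
qed fact

lemma cesaro_mean_nonneg: "0 \<le> cesaro_mean x i"
  by (simp add: cesaro_mean_def sum_nonneg)

lemma cesaro_mean_scale: "cesaro_mean (\<lambda>i. c * x i) i = \<bar>c\<bar> * cesaro_mean x i"
  by (simp add: cesaro_mean_def abs_mult sum_distrib_left[symmetric])

lemma abs_sum_eq_cesaro_mean: "(\<Sum>j\<le>i. \<bar>x j\<bar>) = real (Suc i) * cesaro_mean x i"
  by (simp add: cesaro_mean_def)

text \<open>Differences of partial sums recover the absolute values; signs are lost and must be
  restored separately.\<close>

lemma cesaro_mean_eq_iff: "cesaro_mean x = cesaro_mean y \<longleftrightarrow> (\<forall>i. \<bar>x i\<bar> = \<bar>y i\<bar>)"
proof
  assume eq: "cesaro_mean x = cesaro_mean y"
  have S: "(\<Sum>j\<le>i. \<bar>x j\<bar>) = (\<Sum>j\<le>i. \<bar>y j\<bar>)" for i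
    by (simp only: abs_sum_eq_cesaro_mean eq)
  have "\<bar>x i\<bar> = \<bar>y i\<bar>" for i
  proof (cases i)
    case 0
    then show ?thesis using S[of 0] by simp
  next
    case (Suc n)
    then show ?thesis using S[of i] S[of n] by simp
  qed
  then show "\<forall>i. \<bar>x i\<bar> = \<bar>y i\<bar>" by blast
qed (simp add: cesaro_mean_def fun_eq_iff)

lemma suminf_less:
  fixes f g :: "nat \<Rightarrow> real"
  assumes "summable f" "summable g" "\<And>n. f n \<le> g n" "f k < g k"
  shows "suminf f < suminf g"
proof -
  have "0 < (\<Sum>n. g n - f n)"
    using assms by (intro suminf_pos2[of _ k] summable_diff) auto
  then show ?thesis using suminf_diff[OF assms(2,1)] by simp
qed

text \<open>A mean of \<open>x\<close> below \<open>\<alpha>\<close> can be the midpoint of two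
  means one of which exceeds \<open>\<alpha>\<close>; hence the bound on the midpoint alone.\<close>

lemma strictly_convex_on_midpoint_eq:
  fixes \<phi> :: "real \<Rightarrow> real"
  assumes "convex_on UNIV \<phi>" "strictly_convex_on {0..\<alpha>} \<phi>" "0 \<le> p" "0 \<le> q"
    and eq: "\<phi> ((p + q) / 2) = (\<phi> p + \<phi> q) / 2" and le: "(p + q) / 2 \<le> \<alpha>"
  shows "p = q"
proof -
  have False if pq: "p < q" "0 \<le> p" and eq: "\<phi> ((p + q) / 2) = (\<phi> p + \<phi> q) / 2"
    and le: "(p + q) / 2 \<le> \<alpha>" for p q
  proof -
    \<comment> \<open>Only \<open>[p, m]\<close> need lie in \<open>[0, \<alpha>]\<close>: being strictly below the chord at \<open>u\<close> pulls \<open>m\<close> below it as well.\<close>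
    define m where "m = (p + q) / 2"
    define u where "u = (p + m) / 2"
    have "\<phi> ((1 - 1/2) * p + 1/2 * m) < (1 - 1/2) * \<phi> p + 1/2 * \<phi> m"
      using assms(2)[unfolded strictly_convex_on_def, THEN conjunct2, rule_format, of "1/2" p m]
        pq le by (auto simp: m_def)
    then have 1: "\<phi> u < (\<phi> p + \<phi> m) / 2"
      by (simp add: u_def field_simps)
    have "\<phi> ((1 - 1/3) *\<^sub>R u + (1/3) *\<^sub>R q) \<le> (1 - 1/3) * \<phi> u + 1/3 * \<phi> q"
      by (rule convex_onD[OF assms(1)]) auto
    moreover have "(1 - 1/3) *\<^sub>R u + (1/3) *\<^sub>R q = m"
      by (simp add: u_def m_def field_simps)
    ultimately have "3 * \<phi> m \<le> 2 * \<phi> u + \<phi> q" by simp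
    moreover have "2 * \<phi> u < \<phi> p + \<phi> m" using 1 by simp
    moreover have "2 * \<phi> m = \<phi> p + \<phi> q" using eq by (simp add: m_def)
    ultimately show False by linarith
  qed
  from this[of p q] this[of q p] show ?thesis
    using assms by (force simp: add.commute)
qed

section \<open>Orlicz functions with the doubling condition at zero\<close>

locale delta2_orlicz =
  fixes \<phi> :: "real \<Rightarrow> real"
  assumes orlicz: "orlicz_function \<phi>" and delta2: "delta2_at_zero \<phi>"
begin

lemma nonneg [simp]: "0 \<le> \<phi> u"
  and zero [simp]: "\<phi> 0 = 0"
  and convex: "convex_on UNIV \<phi>"
  and at_top: "filterlim \<phi> at_top at_top"
  using orlicz by (auto simp: orlicz_function_def)

lemma scale_le: "0 \<le> t \<Longrightarrow> t \<le> 1 \<Longrightarrow> \<phi> (t * u) \<le> t * \<phi> u"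
  using convex_onD[OF convex, of t 0 u] by simp

text \<open>The doubling inequality carries positivity from \<open>a\<close> down to every
  \<open>a / 2 ^ n\<close>; convexity with value 0 at 0 carries it up to any \<open>u\<close> above
  one of these points.\<close>

lemma pos: assumes "0 < u" shows "0 < \<phi> u"
proof -
  obtain K a where K: "K > 0" "a > 0" "\<phi> a > 0" and D: "\<And>u. u \<in> {0..a} \<Longrightarrow> \<phi> (2 * u) \<le> K * \<phi> u"
    using delta2 unfolding delta2_at_zero_def by auto
  have P: "0 < \<phi> (a / 2 ^ n)" for n
  proof (induction n)
    case (Suc n)
    have "a / 2 ^ Suc n \<in> {0..a}"
      using K(2) by (auto simp: field_simps simp del: power_Suc intro: order_trans[OF _ mult_left_mono[of 1]])
    from D[OF this] Suc have "0 < K * \<phi> (a / 2 ^ Suc n)" by simp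
    then show ?case using K(1) by (simp add: zero_less_mult_iff)
  qed (use K in simp)
  obtain n where "a / u < 2 ^ n" using real_arch_pow[of 2 "a / u"] by auto
  then have t: "a / 2 ^ n < u" using assms by (simp add: field_simps)
  have "\<phi> (a / 2 ^ n / u * u) \<le> a / 2 ^ n / u * \<phi> u"
    using t assms K(2) by (intro scale_le) (auto simp: field_simps)
  with P[of n] assms have "0 < a / 2 ^ n / u * \<phi> u" by simp
  with assms K(2) show ?thesis by (simp add: zero_less_mult_iff field_simps)
qed

lemma strict_mono: assumes "0 \<le> u" "u < v" shows "\<phi> u < \<phi> v"
proof -
  have "\<phi> (u / v * v) \<le> u / v * \<phi> v" using assms by (intro scale_le) auto
  also have "\<dots> < 1 * \<phi> v" using assms pos[of v] by (intro mult_strict_right_mono) auto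
  finally show ?thesis using assms by simp
qed

lemma le_iff: assumes "0 \<le> u" "0 \<le> v" shows "\<phi> u \<le> \<phi> v \<longleftrightarrow> u \<le> v"
  using strict_mono[of u v] strict_mono[of v u] assms by (cases u v rule: linorder_cases) auto

lemma eq_iff: assumes "0 \<le> u" "0 \<le> v" shows "\<phi> u = \<phi> v \<longleftrightarrow> u = v"
  using strict_mono[of u v] strict_mono[of v u] assms by (cases u v rule: linorder_cases) auto

text \<open>Doubling is controlled only on \<open>[0, a]\<close>, but the terms of a convergent
  series tend to 0, so by strict monotonicity almost all \<open>b i\<close> lie there.\<close>

lemma summable_double:
  assumes b: "\<And>i. 0 \<le> b i" and s: "summable (\<lambda>i. \<phi> (b i))"
  shows "summable (\<lambda>i. \<phi> (2 * b i))"
proof -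
  obtain K a where K: "K > 0" "a > 0" "\<phi> a > 0" and D: "\<And>u. u \<in> {0..a} \<Longrightarrow> \<phi> (2 * u) \<le> K * \<phi> u"
    using delta2 unfolding delta2_at_zero_def by auto
  have "eventually (\<lambda>i. \<phi> (b i) < \<phi> a) sequentially"
    by (rule order_tendstoD(2)[OF summable_LIMSEQ_zero[OF s] K(3)])
  then have "eventually (\<lambda>i. norm (\<phi> (2 * b i)) \<le> K * \<phi> (b i)) sequentially"
  proof eventually_elim
    case (elim i)
    then have "b i \<in> {0..a}" using le_iff[of "b i" a] b K(2) by auto
    from D[OF this] show ?case by simp
  qed
  then show ?thesis by (rule summable_comparison_test_ev) (intro summable_mult s)
qed

text \<open>Repeated doubling dominates every factor \<open>c\<close>.\<close>

lemma summable_scale: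
  assumes b: "\<And>i. 0 \<le> b i" and s: "summable (\<lambda>i. \<phi> (b i))" and "0 \<le> c"
  shows "summable (\<lambda>i. \<phi> (c * b i))"
proof -
  have P: "summable (\<lambda>i. \<phi> (2 ^ n * b i))" for n
  proof (induction n)
    case (Suc n)
    from summable_double[OF _ this] b show ?case by (simp add: mult.assoc)
  qed (use s in simp)
  obtain n where "c < 2 ^ n" using real_arch_pow[of 2 c] by auto
  then have "norm (\<phi> (c * b i)) \<le> \<phi> (2 ^ n * b i)" for i
    using b[of i] \<open>0 \<le> c\<close> by (simp add: le_iff mult_right_mono)
  then show ?thesis by (intro summable_comparison_test'[OF P[of n], of 0]) auto
qed

lemma continuous_on_modular_ray:
  assumes "\<And>i. 0 \<le> b i" and "summable (\<lambda>i. \<phi> (b i))"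
  shows "continuous_on UNIV (\<lambda>c. \<Sum>i. \<phi> (c * b i))"
proof -
  \<comment> \<open>Evenness covers negative \<open>c\<close>, so the series is a finite convex
    function on the whole line, an open set, and therefore continuous.\<close>
  have even: "\<phi> (- u) = \<phi> u" for u using orlicz by (simp add: orlicz_function_def)
  have s: "summable (\<lambda>i. \<phi> (c * b i))" for c
  proof (cases "0 \<le> c")
    case False
    then show ?thesis using summable_scale[OF assms, of "- c"] by (simp add: even)
  qed (rule summable_scale[OF assms])
  have "convex_on UNIV (\<lambda>c. \<phi> (c * b i))" for i
  proof (rule convex_onI)
    fix t x y :: real assume "0 < t" "t < 1"
    then show "\<phi> (((1 - t) *\<^sub>R x + t *\<^sub>R y) * b i) \<le> (1 - t) * \<phi> (x * b i) + t * \<phi> (y * b i)"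
      using convex_onD[OF convex, of t "x * b i" "y * b i"] by (simp add: algebra_simps)
  qed simp
  then show ?thesis
    by (intro convex_on_continuous convex_on_suminf s) auto
qed

section \<open>The modular, the space and the Luxemburg norm\<close>

text \<open>Passes from extended to real series: with nonnegative terms, divergence means the value
  \<open>top\<close>, while a real \<open>suminf\<close> would then carry no information.\<close>

lemma modular_le_1_iff:
  "ces_modular \<phi> x \<le> 1 \<longleftrightarrow>
    summable (\<lambda>i. \<phi> (cesaro_mean x i)) \<and> (\<Sum>i. \<phi> (cesaro_mean x i)) \<le> 1"
proof (cases "summable (\<lambda>i. \<phi> (cesaro_mean x i))")
  case True
  then show ?thesis by (simp add: ces_modular_def suminf_ennreal2)
next
  case False
  then have "ces_modular \<phi> x = top"
    unfolding ces_modular_def using summable_suminf_not_top[of "\<lambda>i. \<phi> (cesaro_mean x i)"] nonneg by blast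
  with False show ?thesis by (simp add: top_unique)
qed

text \<open>By the doubling condition, a finite modular at one scale is finite at all scales, so
  scale 1 decides membership.\<close>

lemma ces_space_iff: "x \<in> ces_space \<phi> \<longleftrightarrow> summable (\<lambda>i. \<phi> (cesaro_mean x i))"
proof
  assume "x \<in> ces_space \<phi>"
  then obtain c where c: "c > 0" "ces_modular \<phi> (\<lambda>i. c * x i) < \<infinity>"
    by (auto simp: ces_space_def)
  then have "summable (\<lambda>i. \<phi> (c * cesaro_mean x i))"
    using summable_suminf_not_top[of "\<lambda>i. \<phi> (c * cesaro_mean x i)"]
    by (simp add: ces_modular_def cesaro_mean_scale less_top)
  from summable_scale[OF _ this, of "1 / c"] c(1) show "summable (\<lambda>i. \<phi> (cesaro_mean x i))"
    by (simp add: cesaro_mean_nonneg)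
next
  assume "summable (\<lambda>i. \<phi> (cesaro_mean x i))"
  then show "x \<in> ces_space \<phi>"
    by (auto simp: ces_space_def ces_modular_def suminf_ennreal2 intro!: exI[of _ 1])
qed

lemma modular_scaled_le_1_iff:
  assumes "x \<in> ces_space \<phi>" "0 < c"
  shows "ces_modular \<phi> (\<lambda>i. x i / c) \<le> 1 \<longleftrightarrow> (\<Sum>i. \<phi> (1 / c * cesaro_mean x i)) \<le> 1"
proof -
  have "cesaro_mean (\<lambda>i. x i / c) i = 1 / c * cesaro_mean x i" for i
    using cesaro_mean_scale[of "1 / c" x i] assms(2) by simp
  moreover have "summable (\<lambda>i. \<phi> (1 / c * cesaro_mean x i))"
    using assms by (intro summable_scale cesaro_mean_nonneg) (auto simp: ces_space_iff)
  ultimately show ?thesis by (simp add: modular_le_1_iff)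
qed

lemma modular_ray_mono:
  assumes "x \<in> ces_space \<phi>" "0 \<le> s" "s \<le> t"
  shows "(\<Sum>i. \<phi> (s * cesaro_mean x i)) \<le> (\<Sum>i. \<phi> (t * cesaro_mean x i))"
  using assms
  by (intro suminf_le summable_scale)
     (auto simp: ces_space_iff cesaro_mean_nonneg le_iff mult_right_mono)

lemma norm_bdd_below: "bdd_below {c. 0 < c \<and> ces_modular \<phi> (\<lambda>i. x i / c) \<le> 1}"
  by (rule bdd_belowI[of _ 0]) auto

text \<open>If \<open>M\<close> is the modular of \<open>x\<close>, convexity bounds the modular of
  \<open>x / (1 + M)\<close> by \<open>M / (1 + M)\<close>. Nonemptiness makes the infimum in the
  norm meaningful.\<close>

lemma norm_set_nonempty:
  assumes "x \<in> ces_space \<phi>"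
  shows "{c. 0 < c \<and> ces_modular \<phi> (\<lambda>i. x i / c) \<le> 1} \<noteq> {}"
proof -
  have s: "summable (\<lambda>i. \<phi> (cesaro_mean x i))" using assms by (simp add: ces_space_iff)
  define M where "M = (\<Sum>i. \<phi> (cesaro_mean x i))"
  have M: "0 \<le> M" unfolding M_def by (intro suminf_nonneg s) auto
  have "(\<Sum>i. \<phi> (1 / (1 + M) * cesaro_mean x i)) \<le> (\<Sum>i. 1 / (1 + M) * \<phi> (cesaro_mean x i))"
    using M s by (intro suminf_le summable_scale cesaro_mean_nonneg summable_mult scale_le) auto
  also have "\<dots> = 1 / (1 + M) * M" unfolding M_def by (rule suminf_mult[OF s])
  also have "\<dots> \<le> 1" using M by (simp add: field_simps)
  finally have "1 + M \<in> {c. 0 < c \<and> ces_modular \<phi> (\<lambda>i. x i / c) \<le> 1}"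
    using M modular_scaled_le_1_iff[OF assms, of "1 + M"] by simp
  then show ?thesis by blast
qed

lemma modular_ray_tendsto:
  assumes "x \<in> ces_space \<phi>"
  shows "((\<lambda>t. \<Sum>i. \<phi> (t * cesaro_mean x i)) \<longlongrightarrow> (\<Sum>i. \<phi> (cesaro_mean x i))) (at 1)"
proof -
  have "continuous_on UNIV (\<lambda>t. \<Sum>i. \<phi> (t * cesaro_mean x i))"
    using assms by (intro continuous_on_modular_ray cesaro_mean_nonneg) (simp add: ces_space_iff)
  then have "isCont (\<lambda>t. \<Sum>i. \<phi> (t * cesaro_mean x i)) 1"
    by (simp add: continuous_on_eq_continuous_at)
  then show ?thesis by (simp add: isCont_def)
qed

text \<open>For \<open>t < 1\<close> some admissible scale lies below \<open>1 / t\<close>, so the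
  modular of \<open>t x\<close> is at most 1; continuity lets \<open>t\<close> tend to 1 from the
  left.\<close>

lemma modular_le_1_of_norm_le_1:
  assumes x: "x \<in> ces_space \<phi>" and n: "ces_norm \<phi> x \<le> 1"
  shows "(\<Sum>i. \<phi> (cesaro_mean x i)) \<le> 1"
proof (rule tendsto_upperbound)
  show "((\<lambda>t. \<Sum>i. \<phi> (t * cesaro_mean x i)) \<longlongrightarrow> (\<Sum>i. \<phi> (cesaro_mean x i))) (at_left 1)"
    using modular_ray_tendsto[OF x] by (simp add: filterlim_at_split)
  have "(\<Sum>i. \<phi> (t * cesaro_mean x i)) \<le> 1" if t: "0 < t" "t < 1" for t
  proof -
    have "1 < 1 / t" using t by simp
    with n have "ces_norm \<phi> x < 1 / t" by linarith
    then obtain c where c: "0 < c" "ces_modular \<phi> (\<lambda>i. x i / c) \<le> 1" "c < 1 / t"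
      unfolding ces_norm_def cInf_less_iff[OF norm_set_nonempty[OF x] norm_bdd_below] by auto
    have "(\<Sum>i. \<phi> (t * cesaro_mean x i)) \<le> (\<Sum>i. \<phi> (1 / c * cesaro_mean x i))"
      using t c by (intro modular_ray_mono x) (auto simp: field_simps)
    also have "\<dots> \<le> 1" using c modular_scaled_le_1_iff[OF x] by simp
    finally show ?thesis .
  qed
  then show "eventually (\<lambda>t. (\<Sum>i. \<phi> (t * cesaro_mean x i)) \<le> 1) (at_left 1)"
    by (intro eventually_at_leftI[of 0]) auto
qed simp

text \<open>For the lower bound, a modular of \<open>t x\<close> below 1 with \<open>t > 1\<close>
  would make \<open>1 / t < 1\<close> an admissible scale; then \<open>t\<close> tends to 1 from the
  right.\<close>

lemma modular_eq_1_of_norm_eq_1: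
  assumes x: "x \<in> ces_space \<phi>" and n: "ces_norm \<phi> x = 1"
  shows "(\<Sum>i. \<phi> (cesaro_mean x i)) = 1"
proof (rule antisym)
  show "(\<Sum>i. \<phi> (cesaro_mean x i)) \<le> 1" using modular_le_1_of_norm_le_1[OF x] n by simp
  show "1 \<le> (\<Sum>i. \<phi> (cesaro_mean x i))"
  proof (rule tendsto_lowerbound)
    show "((\<lambda>t. \<Sum>i. \<phi> (t * cesaro_mean x i)) \<longlongrightarrow> (\<Sum>i. \<phi> (cesaro_mean x i))) (at_right 1)"
      using modular_ray_tendsto[OF x] by (simp add: filterlim_at_split)
    have "1 \<le> (\<Sum>i. \<phi> (t * cesaro_mean x i))" if t: "1 < t" "t < 2" for t
    proof (rule ccontr)
      assume "\<not> ?thesis"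
      then have "1 / t \<in> {c. 0 < c \<and> ces_modular \<phi> (\<lambda>i. x i / c) \<le> 1}"
        using t modular_scaled_le_1_iff[OF x, of "1 / t"] by simp
      then have "ces_norm \<phi> x \<le> 1 / t"
        unfolding ces_norm_def by (rule cInf_lower[OF _ norm_bdd_below])
      with n t show False by (simp add: le_divide_eq)
    qed
    then show "eventually (\<lambda>t. 1 \<le> (\<Sum>i. \<phi> (t * cesaro_mean x i))) (at_right 1)"
      by (intro eventually_at_rightI[of _ 2]) auto
  qed simp
qed

lemma norm_le_1_of_modular_le_1:
  assumes x: "x \<in> ces_space \<phi>" and m: "(\<Sum>i. \<phi> (cesaro_mean x i)) \<le> 1"
  shows "ces_norm \<phi> x \<le> 1"
  unfolding ces_norm_def
  by (rule cInf_lower[OF _ norm_bdd_below]) (use modular_scaled_le_1_iff[OF x, of 1] m in simp)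

text \<open>An admissible scale \<open>c < 1\<close> is impossible: by convexity the modular of
  \<open>x\<close> is at most \<open>c\<close> times that of \<open>x / c\<close>, hence at most
  \<open>c\<close>.\<close>

lemma norm_eq_1_of_modular_eq_1:
  assumes x: "x \<in> ces_space \<phi>" and m: "(\<Sum>i. \<phi> (cesaro_mean x i)) = 1"
  shows "ces_norm \<phi> x = 1"
proof (rule antisym)
  show "ces_norm \<phi> x \<le> 1" using norm_le_1_of_modular_le_1[OF x] m by simp
  show "1 \<le> ces_norm \<phi> x"
    unfolding ces_norm_def
  proof (rule cInf_greatest[OF norm_set_nonempty[OF x]], clarsimp)
    fix c assume c: "0 < c" "ces_modular \<phi> (\<lambda>i. x i / c) \<le> 1"
    then have s: "summable (\<lambda>i. \<phi> (1 / c * cesaro_mean x i))"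
      using x by (intro summable_scale cesaro_mean_nonneg) (auto simp: ces_space_iff)
    show "1 \<le> c"
    proof (rule ccontr)
      assume *: "\<not> 1 \<le> c"
      have "1 = (\<Sum>i. \<phi> (c * (1 / c * cesaro_mean x i)))" using m c by simp
      also have "\<dots> \<le> (\<Sum>i. c * \<phi> (1 / c * cesaro_mean x i))"
        using * c x by (intro suminf_le scale_le summable_mult s) (auto simp: ces_space_iff)
      also have "\<dots> = c * (\<Sum>i. \<phi> (1 / c * cesaro_mean x i))" by (rule suminf_mult[OF s])
      also have "\<dots> \<le> c" using c modular_scaled_le_1_iff[OF x c(1)] by simp
      finally show False using * by simp
    qed
  qed
qed

section \<open>The function f and sufficiency of strict convexity\<close>

text \<open>A nonzero entry \<open>x k\<close> keeps all later means above
  \<open>\<bar>x k\<bar> / (n + 1)\<close>; rescaling this harmonic sequence gives the series in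
  \<open>ces_f\<close>.\<close>

lemma summable_ces_f_tail:
  assumes ne: "ces_space \<phi> \<noteq> {\<lambda>_. 0}" and a: "0 \<le> a"
  shows "summable (\<lambda>n. \<phi> (2 / real (n + 3) * a))"
proof -
  have "(\<lambda>_. 0) \<in> ces_space \<phi>" by (simp add: ces_space_iff cesaro_mean_def)
  with ne obtain x k where x: "x \<in> ces_space \<phi>" "x k \<noteq> 0" by (auto simp: fun_eq_iff)
  have "summable (\<lambda>n. \<phi> (\<bar>x k\<bar> / real (Suc n)))"
  proof (rule summable_comparison_test'[of _ k])
    show "summable (\<lambda>n. \<phi> (cesaro_mean x n))" using x by (simp add: ces_space_iff)
    fix n assume "k \<le> n"
    then have "\<bar>x k\<bar> \<le> (\<Sum>j\<le>n. \<bar>x j\<bar>)" by (intro member_le_sum) auto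
    then show "norm (\<phi> (\<bar>x k\<bar> / real (Suc n))) \<le> \<phi> (cesaro_mean x n)"
      by (simp add: le_iff cesaro_mean_nonneg) (simp add: cesaro_mean_def divide_right_mono)
  qed
  then have "summable (\<lambda>n. \<phi> (\<bar>x k\<bar> / real (Suc (n + 2))))"
    by (rule summable_ignore_initial_segment)
  then have "summable (\<lambda>n. \<phi> (2 * a / \<bar>x k\<bar> * (\<bar>x k\<bar> / real (Suc (n + 2)))))"
    using a by (intro summable_scale) auto
  moreover have "2 * a / \<bar>x k\<bar> * (\<bar>x k\<bar> / real (Suc (n + 2))) = 2 / real (n + 3) * a" for n
    using x(2) by (simp add: field_simps)
  ultimately show ?thesis by simp
qed

text \<open>The two large means account for \<open>2 * \<phi> a\<close>. The partial sum at
  \<open>k\<close> exceeds \<open>(k + 1) a\<close> and never decreases, so later means dominate the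
  tail of \<open>ces_f\<close> term by term; \<open>k = 1\<close> is the extreme case.\<close>

lemma ces_f_less_modular:
  assumes ne: "ces_space \<phi> \<noteq> {\<lambda>_. 0}" and x: "x \<in> ces_space \<phi>"
    and ik: "i < k" and a: "0 < a" "a < cesaro_mean x i" "a < cesaro_mean x k"
  shows "ces_f \<phi> a < (\<Sum>n. \<phi> (cesaro_mean x n))"
proof -
  have s: "summable (\<lambda>n. \<phi> (cesaro_mean x n))" using x by (simp add: ces_space_iff)
  have "2 * \<phi> a < \<phi> (cesaro_mean x i) + \<phi> (cesaro_mean x k)"
    using strict_mono[OF _ a(2)] strict_mono[OF _ a(3)] a(1) by simp
  also have "\<dots> = (\<Sum>n\<in>{i, k}. \<phi> (cesaro_mean x n))" using ik by simp
  also have "\<dots> \<le> (\<Sum>n<Suc k. \<phi> (cesaro_mean x n))" using ik by (intro sum_mono2) auto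
  finally have head: "2 * \<phi> a < (\<Sum>n<Suc k. \<phi> (cesaro_mean x n))" .
  have "2 / real (n + 3) * a \<le> cesaro_mean x (n + Suc k)" for n
  proof -
    have "1 \<le> real k" using ik by simp
    \<comment> \<open>This is \<open>(k - 1)(n + 1)\<close>, the cross-multiplied difference
      \<open>(k + 1)(n + 3) - 2 (n + k + 2)\<close> of the two fractions below.\<close>
    then have "0 \<le> (real k - 1) * real n + (real k - 1)" by simp
    then have "2 / real (n + 3) \<le> real (Suc k) / real (Suc (n + Suc k))"
      by (simp add: divide_simps) (simp add: algebra_simps)
    then have "2 / real (n + 3) * a \<le> real (Suc k) / real (Suc (n + Suc k)) * a"
      using a(1) by (intro mult_right_mono) auto
    also have "\<dots> \<le> real (Suc k) / real (Suc (n + Suc k)) * cesaro_mean x k"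
      using a(3) by (intro mult_left_mono) auto
    also have "\<dots> = (\<Sum>j\<le>k. \<bar>x j\<bar>) / real (Suc (n + Suc k))"
      by (simp add: abs_sum_eq_cesaro_mean)
    also have "\<dots> \<le> cesaro_mean x (n + Suc k)"
      unfolding cesaro_mean_def by (intro divide_right_mono sum_mono2) auto
    finally show ?thesis .
  qed
  then have "(\<Sum>n. \<phi> (2 / real (n + 3) * a)) \<le> (\<Sum>n. \<phi> (cesaro_mean x (n + Suc k)))"
    using a(1) ne
    by (intro suminf_le summable_ces_f_tail summable_ignore_initial_segment[OF s])
       (auto simp: le_iff cesaro_mean_nonneg)
  with head show ?thesis
    unfolding ces_f_def suminf_split_initial_segment[OF s, of "Suc k"] by linarith
qed

section \<open>Strict convexity implies rotundity\<close>

lemma rotund_if_strictly_convex: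
  assumes ne: "ces_space \<phi> \<noteq> {\<lambda>_. 0}" and \<alpha>: "0 < \<alpha>" "ces_f \<phi> \<alpha> = 1"
    and sc: "strictly_convex_on {0..\<alpha>} \<phi>"
  shows "rotund (ces_space \<phi>) (ces_norm \<phi>)"
  unfolding rotund_def unit_sphere_def unit_ball_def
proof (intro ballI impI; clarsimp)
  fix x y z
  assume x: "x \<in> ces_space \<phi>" "ces_norm \<phi> x = 1" and y: "y \<in> ces_space \<phi>" "ces_norm \<phi> y \<le> 1"
    and z: "z \<in> ces_space \<phi>" "ces_norm \<phi> z \<le> 1" and xyz: "\<forall>i. 2 * x i = y i + z i"
  define X Y Z where "X = cesaro_mean x" and "Y = cesaro_mean y" and "Z = cesaro_mean z"
  have nn [simp]: "0 \<le> X i" "0 \<le> Y i" "0 \<le> Z i" for i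
    by (auto simp: X_def Y_def Z_def cesaro_mean_nonneg)
  have sX: "summable (\<lambda>i. \<phi> (X i))" and sY: "summable (\<lambda>i. \<phi> (Y i))" and sZ: "summable (\<lambda>i. \<phi> (Z i))"
    using x y z by (auto simp: X_def Y_def Z_def ces_space_iff)
  have mX: "(\<Sum>i. \<phi> (X i)) = 1" and mY: "(\<Sum>i. \<phi> (Y i)) \<le> 1" and mZ: "(\<Sum>i. \<phi> (Z i)) \<le> 1"
    using modular_eq_1_of_norm_eq_1[OF x] modular_le_1_of_norm_le_1[OF y] modular_le_1_of_norm_le_1[OF z]
    by (auto simp: X_def Y_def Z_def)
  \<comment> \<open>Writing the midpoint as a Cesaro mean gives both the bound on \<open>X\<close>
    and, at the end, the absolute values of \<open>x\<close>.\<close>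
  have mid: "(Y i + Z i) / 2 = cesaro_mean (\<lambda>j. (\<bar>y j\<bar> + \<bar>z j\<bar>) / 2) i" for i
    by (simp add: Y_def Z_def cesaro_mean_def sum.distrib sum_divide_distrib[symmetric]
        add_divide_distrib mult.commute)
  have Xle: "X i \<le> (Y i + Z i) / 2" for i
  proof -
    have "\<bar>x j\<bar> \<le> \<bar>(\<bar>y j\<bar> + \<bar>z j\<bar>) / 2\<bar>" for j
    proof -
      have "2 * \<bar>x j\<bar> = \<bar>y j + z j\<bar>" using xyz by (metis abs_mult abs_numeral)
      then show ?thesis using abs_triangle_ineq[of "y j" "z j"] by simp
    qed
    then show ?thesis unfolding mid X_def cesaro_mean_def by (intro divide_right_mono sum_mono) auto
  qed
  have \<phi>X: "\<phi> (X i) \<le> \<phi> ((Y i + Z i) / 2)" for i using Xle by (simp add: le_iff)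
  have \<phi>mid: "\<phi> ((Y i + Z i) / 2) \<le> (\<phi> (Y i) + \<phi> (Z i)) / 2" for i
    using convex_onD[OF convex, of "1/2" "Y i" "Z i"] by (simp add: add_divide_distrib)
  have sYZ: "summable (\<lambda>i. (\<phi> (Y i) + \<phi> (Z i)) / 2)" by (intro summable_divide summable_add sY sZ)
  have YZ: "2 * (\<Sum>i. (\<phi> (Y i) + \<phi> (Z i)) / 2) = (\<Sum>i. \<phi> (Y i)) + (\<Sum>i. \<phi> (Z i))"
    using suminf_divide[OF summable_add[OF sY sZ], of 2] suminf_add[OF sY sZ] by simp
  \<comment> \<open>The left sides sum to 1 and the right sides to at most 1, so no term can be
    strict.\<close>
  have tight: "\<phi> (X i) = (\<phi> (Y i) + \<phi> (Z i)) / 2" for i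
  proof (rule ccontr)
    assume "\<phi> (X i) \<noteq> (\<phi> (Y i) + \<phi> (Z i)) / 2"
    then have "\<phi> (X i) < (\<phi> (Y i) + \<phi> (Z i)) / 2" using \<phi>X[of i] \<phi>mid[of i] by linarith
    from suminf_less[OF sX sYZ order_trans[OF \<phi>X \<phi>mid] this] show False
      using YZ mX mY mZ by linarith
  qed
  have Xeq: "X i = (Y i + Z i) / 2" for i
    using \<phi>X[of i] \<phi>mid[of i] tight[of i] eq_iff[of "X i" "(Y i + Z i) / 2"] by simp
  have small: "Y i = Z i" if "X i \<le> \<alpha>" for i
    using strictly_convex_on_midpoint_eq[OF convex sc nn(2,3) tight[of i, unfolded Xeq]] that
    unfolding Xeq .
  have "2 * (\<Sum>i. \<phi> (X i)) = (\<Sum>i. \<phi> (Y i)) + (\<Sum>i. \<phi> (Z i))"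
    unfolding tight by (rule YZ)
  then have sums_eq: "(\<Sum>i. \<phi> (Y i)) = (\<Sum>i. \<phi> (Z i))"
    using mX mY mZ by linarith
  have "Y i = Z i" for i
  proof (rule ccontr)
    assume ne': "Y i \<noteq> Z i"
    have others: "Y j = Z j" if "j \<noteq> i" for j
    proof (rule ccontr)
      assume "Y j \<noteq> Z j"
      with ne' have "\<alpha> < X i" "\<alpha> < X j" using small by (auto simp: not_le[symmetric])
      with that have "ces_f \<phi> \<alpha> < (\<Sum>n. \<phi> (X n))"
        using ces_f_less_modular[OF ne x(1) _ \<alpha>(1)] unfolding X_def by (metis linorder_neqE_nat)
      with \<alpha> mX show False by simp
    qed
    have "\<phi> (Y i) \<noteq> \<phi> (Z i)" using ne' by (simp add: eq_iff)
    then consider "\<phi> (Y i) < \<phi> (Z i)" | "\<phi> (Z i) < \<phi> (Y i)" by linarith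
    then show False
    proof cases
      case 1
      with others have "\<phi> (Y j) \<le> \<phi> (Z j)" for j by (cases "j = i") auto
      from suminf_less[OF sY sZ this 1] sums_eq show False by simp
    next
      case 2
      with others have "\<phi> (Z j) \<le> \<phi> (Y j)" for j by (cases "j = i") auto
      from suminf_less[OF sZ sY this 2] sums_eq show False by simp
    qed
  qed
  then have "Y = Z" by blast
  then have yz: "\<bar>y i\<bar> = \<bar>z i\<bar>" for i unfolding Y_def Z_def cesaro_mean_eq_iff by blast
  have "cesaro_mean x = cesaro_mean (\<lambda>j. (\<bar>y j\<bar> + \<bar>z j\<bar>) / 2)"
    using Xeq mid by (auto simp: X_def fun_eq_iff)
  then have "\<bar>x i\<bar> = \<bar>(\<bar>y i\<bar> + \<bar>z i\<bar>) / 2\<bar>" for i unfolding cesaro_mean_eq_iff by blast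
  then have xz: "\<bar>x i\<bar> = \<bar>z i\<bar>" for i using yz by simp
  \<comment> \<open>Signs: if \<open>y i = - z i\<close> then \<open>x i = 0\<close>, and as all
    three absolute values agree, both entries vanish.\<close>
  have "y i = z i" for i
    using yz[of i] xyz[rule_format, of i] xz[of i] by (auto simp: abs_eq_iff)
  then show "y = z" by blast
qed

section \<open>Rotundity implies strict convexity\<close>

lemma strictly_convex_if_rotund:
  assumes ne: "ces_space \<phi> \<noteq> {\<lambda>_. 0}" and \<alpha>: "0 < \<alpha>" "ces_f \<phi> \<alpha> = 1"
    and rot: "rotund (ces_space \<phi>) (ces_norm \<phi>)"
  shows "strictly_convex_on {0..\<alpha>} \<phi>"
proof (rule ccontr)
  assume "\<not> ?thesis"
  then obtain t u v where t: "0 < t" "t < 1" and uv: "0 \<le> u" "u \<le> \<alpha>" "0 \<le> v" "v \<le> \<alpha>" "u \<noteq> v"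
    and flat: "(1 - t) * \<phi> u + t * \<phi> v \<le> \<phi> ((1 - t) * u + t * v)"
    by (auto simp: strictly_convex_on_def not_less)
  define c where "c = (1 - t) * u + t * v"
  have c: "0 < c"
  proof (cases "u = 0")
    case True
    then show ?thesis using t uv by (simp add: c_def)
  next
    case False
    then have "0 < (1 - t) * u" "0 \<le> t * v" using t uv by auto
    then show ?thesis by (simp add: c_def)
  qed
  \<comment> \<open>The bounds by \<open>t\<close> and \<open>1 - t\<close> keep
    \<open>c + d\<close> and \<open>c - d\<close> between \<open>u\<close> and \<open>v\<close>; the
    last one yields \<open>3 * \<bar>d\<bar> \<le> c\<close>, which makes the entries
    \<open>c - 3 * e\<close> below nonnegative.\<close>
  define s where "s = min (min t (1 - t)) (c / (3 * \<bar>v - u\<bar>))"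
  have s: "0 < s" "s \<le> t" "s \<le> 1 - t" using t c uv by (auto simp: s_def)
  define d where "d = s * (v - u)"
  have d0: "d \<noteq> 0" using s uv by (simp add: d_def)
  have "s \<le> c / (3 * \<bar>v - u\<bar>)" by (simp add: s_def)
  then have d3: "3 * \<bar>d\<bar> \<le> c"
    using uv(5) s(1) by (simp add: d_def abs_mult pos_le_divide_eq mult.left_commute)
  have cp: "c + d = (1 - (t + s)) * u + (t + s) * v" and cm: "c - d = (1 - (t - s)) * u + (t - s) * v"
    by (auto simp: c_def d_def algebra_simps)
  have range: "(1 - r) * u + r * v \<le> \<alpha>" if "0 \<le> r" "r \<le> 1" for r
    using convex_bound_le[of u \<alpha> v "1 - r" r] uv that by simp
  have cd\<alpha>: "c + d \<le> \<alpha>" "c - d \<le> \<alpha>"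
    unfolding cp cm using s t by (auto intro!: range)
  \<comment> \<open>The chord lies above \<open>\<phi>\<close> at both points; its two values there
    average to its value at \<open>c\<close>, which is at most \<open>\<phi> c\<close> by
    \<open>flat\<close>.\<close>
  have "\<phi> (c + d) + \<phi> (c - d) \<le>
      (1 - (t + s)) * \<phi> u + (t + s) * \<phi> v + ((1 - (t - s)) * \<phi> u + (t - s) * \<phi> v)"
    using convex_onD[OF convex, of "t + s" u v] convex_onD[OF convex, of "t - s" u v] s t
    unfolding cp cm by (intro add_mono) auto
  also have "\<dots> = 2 * ((1 - t) * \<phi> u + t * \<phi> v)" by (simp add: algebra_simps)
  also have "\<dots> \<le> 2 * \<phi> c" using flat by (simp add: c_def)
  finally have \<phi>cd: "\<phi> (c + d) + \<phi> (c - d) \<le> 2 * \<phi> c" .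

  \<comment> \<open>\<open>T g\<close> is the modular of the means from index 2 on when the first
    three entries are nonnegative with sum \<open>2 g\<close> and the rest vanish.\<close>
  define T where "T g = (\<Sum>n. \<phi> (g * (2 / real (n + 3))))" for g
  have sT: "summable (\<lambda>n. \<phi> (g * (2 / real (n + 3))))" if "0 \<le> g" for g
    using summable_ces_f_tail[OF ne that] by (simp add: mult.commute)
  have cT: "continuous_on UNIV T"
    unfolding T_def using sT[of 1] by (intro continuous_on_modular_ray) auto
  have "c \<le> \<alpha>" using cd\<alpha> by linarith
  then have "\<phi> c \<le> \<phi> \<alpha>" using c \<alpha> by (simp add: le_iff)
  moreover have "2 * \<phi> \<alpha> + T \<alpha> = 1"
    using \<alpha>(2) by (simp add: ces_f_def T_def mult.commute)
  ultimately have start: "2 * \<phi> c + T \<alpha> \<le> 1" by linarith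
  have "eventually (\<lambda>g. 1 \<le> \<phi> g \<and> \<alpha> \<le> g) at_top"
    using at_top unfolding filterlim_at_top by (intro eventually_conj eventually_ge_at_top) blast
  then obtain h where h: "1 \<le> \<phi> h" "\<alpha> \<le> h" 
    using eventually_happens'[OF trivial_limit_at_top_linorder] by blast
  \<comment> \<open>The factor 3/2 cancels the 2/3 in the first term of \<open>T\<close>, giving the
    upper endpoint for the intermediate value theorem.\<close>
  have "\<phi> h \<le> T (3 / 2 * h)"
    using sum_le_suminf[OF sT[of "3 / 2 * h"], of "{0}"] h \<alpha> by (simp add: T_def)
  then have "1 \<le> 2 * \<phi> c + T (3 / 2 * h)" using h nonneg[of c] by linarith
  moreover have "continuous_on {\<alpha>..3 / 2 * h} (\<lambda>g. 2 * \<phi> c + T g)"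
    by (intro continuous_intros continuous_on_subset[OF cT]) simp
  ultimately obtain g where g: "\<alpha> \<le> g" "2 * \<phi> c + T g = 1"
    using IVT'[of "\<lambda>g. 2 * \<phi> c + T g" \<alpha> 1 "3 / 2 * h"] start h \<alpha>
    by auto

  define w where "w e i = (if i = 0 then c + e else if i = 1 then c - 3 * e
      else if i = 2 then 2 * g - 2 * c + 2 * e else 0)" for e :: real and i :: nat
  \<comment> \<open>The entries of \<open>w e\<close> are chosen to make its means \<open>c + e, c - e, 2g/3, 2g/4, ...\<close>.\<close>
  have w: "w e \<in> ces_space \<phi> \<and>
      (\<Sum>i. \<phi> (cesaro_mean (w e) i)) = \<phi> (c + e) + \<phi> (c - e) + T g"
    if e: "3 * \<bar>e\<bar> \<le> c" "c - e \<le> \<alpha>" for e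
  proof -
    \<comment> \<open>The first two entries use \<open>3 * \<bar>e\<bar> \<le> c\<close>, the third
      \<open>c - e \<le> \<alpha> \<le> g\<close>.\<close>
    have nonneg_w: "0 \<le> w e i" for i using e g by (auto simp: w_def)
    have tail: "cesaro_mean (w e) (n + 2) = g * (2 / real (n + 3))" for n
    proof -
      have "(\<Sum>j\<le>n + 2. \<bar>w e j\<bar>) = (\<Sum>j\<in>{0, 1, 2}. \<bar>w e j\<bar>)"
        by (rule sum.mono_neutral_right) (auto simp: w_def)
      also have "\<dots> = w e 0 + w e 1 + w e 2" using nonneg_w by simp
      also have "\<dots> = 2 * g" by (simp add: w_def)
      finally show ?thesis by (simp add: cesaro_mean_def add.commute)
    qed
    have 0: "cesaro_mean (w e) 0 = c + e" using nonneg_w[of 0] by (simp add: cesaro_mean_def w_def)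
    have 1: "cesaro_mean (w e) (Suc 0) = c - e"
      using nonneg_w[of 0] nonneg_w[of 1] by (simp add: cesaro_mean_def w_def)
    have "summable (\<lambda>n. \<phi> (cesaro_mean (w e) (n + 2)))"
      unfolding tail using g \<alpha> by (intro sT) simp
    then have s: "summable (\<lambda>n. \<phi> (cesaro_mean (w e) n))"
      by (rule summable_iff_shift[THEN iffD1])
    have "(\<Sum>n<2. \<phi> (cesaro_mean (w e) n)) = \<phi> (c + e) + \<phi> (c - e)"
      by (simp add: numeral_2_eq_2 0 1)
    then show ?thesis
      using s suminf_split_initial_segment[OF s, of 2] unfolding tail by (simp add: ces_space_iff T_def)
  qed
  have "w 0 \<in> unit_sphere (ces_space \<phi>) (ces_norm \<phi>)"
    using w[of 0] c \<open>c \<le> \<alpha>\<close> g by (auto simp: unit_sphere_def intro!: norm_eq_1_of_modular_eq_1)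
  moreover have "w d \<in> unit_ball (ces_space \<phi>) (ces_norm \<phi>)"
    using w[of d] d3 cd\<alpha> \<phi>cd g by (auto simp: unit_ball_def intro!: norm_le_1_of_modular_le_1)
  moreover have "w (- d) \<in> unit_ball (ces_space \<phi>) (ces_norm \<phi>)"
    using w[of "- d"] d3 cd\<alpha> \<phi>cd g by (auto simp: unit_ball_def intro!: norm_le_1_of_modular_le_1)
  \<comment> \<open>Every entry of \<open>w e\<close> is affine in \<open>e\<close>, so
    \<open>w 0\<close> is the midpoint.\<close>
  moreover have "\<forall>i. 2 * w 0 i = w d i + w (- d) i" by (simp add: w_def)
  ultimately have "w d = w (- d)" using rot unfolding rotund_def by blast
  then have "w d 0 = w (- d) 0" by simp
  with d0 show False by (simp add: w_def)
qed

end

theorem theorem2p7: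
  fixes \<phi> :: "real \<Rightarrow> real" and \<alpha> :: real
  assumes "orlicz_function \<phi>"
    and "ces_space \<phi> \<noteq> {\<lambda>_. 0}"
    and "\<alpha> > 0" and "ces_f \<phi> \<alpha> = 1"
    and "delta2_at_zero \<phi>"
  shows "rotund (ces_space \<phi>) (ces_norm \<phi>) \<longleftrightarrow> strictly_convex_on {0..\<alpha>} \<phi>"
proof -
  interpret delta2_orlicz \<phi> by unfold_locales fact+
  show ?thesis
    using strictly_convex_if_rotund[OF assms(2-4)] rotund_if_strictly_convex[OF assms(2-4)] by blast
qed

end
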